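(* Let $X$ be a real Banach space, let $x\in S_X$ be an F-smooth point of $X$ and let $f\in S_{X^*}$ be a G-smooth point of $X^*$ such that $f(x)=1$. Then $x$ is an $\omega$-LUR point.
   Context: For a real Banach space $X$, $B_X$ is the closed unit ball, $S_X$ the unit sphere. A point $x\in S_X$ is F-smooth if the norm of $X$ is Fréchet differentiable at $x$. A point of the unit sphere of a Banach space $Y$ is G-smooth if the norm of $Y$ is Gâteaux differentiable at that point; equivalently, $y\in S_Y$ is G-smooth iff there is a unique $\psi\in S_{Y^*}$ with $\psi(y)=1$. A point $x\in S_X$ is an $\omega$-LUR (weakly locally uniformly rotund) point if for all sequences $(x_n)\subset B_X$ such that $\lim_{n\to\infty}\|x+x_n\|=2$ it holds that $x_n\to x$ in the weak topology of $X$. *)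

theory Defs
  imports "HOL-Analysis.Analysis"
begin

definition gateaux_differentiable ::
    "('a::real_normed_vector \<Rightarrow> 'b::real_normed_vector) \<Rightarrow> 'a \<Rightarrow> bool" where
  "gateaux_differentiable g x \<longleftrightarrow>
     (\<exists>D. bounded_linear D \<and>
       (\<forall>h. ((\<lambda>t. (g (x + t *\<^sub>R h) - g x) /\<^sub>R t) \<longlongrightarrow> D h) (at (0::real))))"

definition F_smooth :: "'a::real_normed_vector \<Rightarrow> bool" where
  "F_smooth x \<longleftrightarrow> x \<in> sphere 0 1 \<and> norm differentiable (at x)"

definition G_smooth :: "'a::real_normed_vector \<Rightarrow> bool" where
  "G_smooth y \<longleftrightarrow> y \<in> sphere 0 1 \<and> gateaux_differentiable norm y"

text \<open>The initial topology for all continuous linear functionals: the type of functions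
  \<^typ>\<open>('a \<Rightarrow>\<^sub>L real) \<Rightarrow> real\<close> carries the topology of pointwise convergence.\<close>

definition weak_topology :: "'a::real_normed_vector topology" where
  "weak_topology = pullback_topology UNIV (\<lambda>x (f :: 'a \<Rightarrow>\<^sub>L real). blinfun_apply f x) euclidean"

lemma limitin_weak_topology:
  fixes s :: "nat \<Rightarrow> 'a::real_normed_vector"
  shows "limitin weak_topology s x sequentially \<longleftrightarrow>
    (\<forall>f :: 'a \<Rightarrow>\<^sub>L real. (\<lambda>n. blinfun_apply f (s n)) \<longlonglongrightarrow> blinfun_apply f x)"
proof -
  let ?J = "\<lambda>x (f :: 'a \<Rightarrow>\<^sub>L real). blinfun_apply f x"
  have "limitin weak_topology s x sequentially \<longleftrightarrow> (\<lambda>n. ?J (s n)) \<longlonglongrightarrow> ?J x"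
    unfolding limitin_def weak_topology_def tendsto_def
    by (auto simp: openin_pullback_topology topspace_pullback_topology)
  also have "\<dots> \<longleftrightarrow>
      limitin (product_topology (\<lambda>f :: 'a \<Rightarrow>\<^sub>L real. euclidean) UNIV)
        (\<lambda>n. ?J (s n)) (?J x) sequentially"
    by (simp add: euclidean_product_topology)
  also have "\<dots> \<longleftrightarrow> (\<forall>f :: 'a \<Rightarrow>\<^sub>L real. (\<lambda>n. f (s n)) \<longlonglongrightarrow> f x)"
    by (simp add: limitin_componentwise)
  finally show ?thesis .
qed

definition wLUR_point :: "'a::real_normed_vector \<Rightarrow> bool" where
  "wLUR_point x \<longleftrightarrow> x \<in> sphere 0 1 \<and>
     (\<forall>s :: nat \<Rightarrow> 'a. (\<forall>n. s n \<in> cball 0 1) \<longrightarrow> (\<lambda>n. norm (x + s n)) \<longlonglongrightarrow> 2 \<longrightarrow>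
        limitin weak_topology s x sequentially)"

end

theory Submission
  imports Defs
begin

text \<open>
  Since \<open>f\<close> is a subgradient of the norm at \<open>x\<close>, it is the Frechet derivative there. For small
  \<open>t > 0\<close> the triangle inequality gives
  \<open>\<parallel>x + x\<^sub>n\<parallel> - (1 - t) \<le> \<parallel>x + t x\<^sub>n\<parallel> \<le> 1 + t f(x\<^sub>n) + o(t)\<close>, where \<open>o(t)\<close> is uniform in \<open>n\<close>; hence
  \<open>f(x\<^sub>n) \<longrightarrow> 1\<close>. Dually, evaluation at \<open>x\<close> is the Gateaux derivative of the dual norm at \<open>f\<close>, so
  \<open>g(x\<^sub>n) \<le> (\<parallel>f + t g\<parallel> - f(x\<^sub>n)) / t\<close> bounds the limit superior of \<open>g(x\<^sub>n)\<close> by \<open>g(x)\<close>; the same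
  bound for \<open>-g\<close> gives weak convergence.
\<close>

text \<open>Subtracting the affine minorant, which touches \<open>\<phi>\<close> at
  \<open>a\<close>, leaves a function with a minimum at \<open>a\<close>, so its derivative
  \<open>d - c\<close> vanishes.\<close>

lemma DERIV_eq_subgradient:
  fixes \<phi> :: "real \<Rightarrow> real"
  assumes "(\<phi> has_real_derivative d) (at a)"
    and "\<And>t. \<phi> a + (t - a) * c \<le> \<phi> t"
  shows "d = c"
proof -
  have "((\<lambda>t. \<phi> t - (t - a) * c) has_real_derivative d - c) (at a)"
    by (auto intro!: derivative_eq_intros assms(1))
  then have "d - c = 0"
  proof (rule DERIV_local_min[where d = 1])
    show "\<forall>y. \<bar>a - y\<bar> < 1 \<longrightarrow> \<phi> a - (a - a) * c \<le> \<phi> y - (y - a) * c"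
      using assms(2) by (auto simp: le_diff_eq)
  qed simp
  then show ?thesis by simp
qed

lemma blinfun_apply_le_norm:
  fixes f :: "'a::real_normed_vector \<Rightarrow>\<^sub>L real"
  assumes "norm y \<le> 1"
  shows "f y \<le> norm f"
proof -
  have "f y \<le> norm f * norm y"
    using norm_blinfun[of f y] by simp
  also have "\<dots> \<le> norm f"
    using mult_left_mono[OF assms norm_ge_zero[of f]] by simp
  finally show ?thesis .
qed

text \<open>Along each line \<open>t \<mapsto> x + t *\<^sub>R h\<close> the functional
  \<open>f\<close> stays below the norm and agrees with it at \<open>t = 0\<close>, so
  \<open>f h\<close> is the slope of an affine minorant there.\<close>

lemma has_derivative_norm_eq_norming_functional:
  fixes f :: "'a::real_normed_vector \<Rightarrow>\<^sub>L real"
  assumes D: "(norm has_derivative D) (at x)"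
    and "norm f \<le> 1" "f x = norm x"
  shows "D = blinfun_apply f"
proof
  fix h
  have bl: "bounded_linear D"
    using D by (rule has_derivative_bounded_linear)
  have "((\<lambda>t::real. x + t *\<^sub>R h) has_derivative (\<lambda>t. t *\<^sub>R h)) (at 0)"
    by (auto intro!: derivative_eq_intros)
  then have "((\<lambda>t::real. norm (x + t *\<^sub>R h)) has_derivative (\<lambda>t. D (t *\<^sub>R h))) (at 0)"
    by (rule has_derivative_compose) (simp add: D)
  then have "((\<lambda>t::real. norm (x + t *\<^sub>R h)) has_real_derivative D h) (at 0)"
    by (simp add: has_field_derivative_def linear_cmul[OF bounded_linear.linear[OF bl]]
        mult_commute_abs)
  then show "D h = f h"
  proof (rule DERIV_eq_subgradient)
    fix t :: real
    have "f (x + t *\<^sub>R h) \<le> norm f * norm (x + t *\<^sub>R h)"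
      using norm_blinfun[of f "x + t *\<^sub>R h"] by simp
    also have "\<dots> \<le> norm (x + t *\<^sub>R h)"
      using mult_right_mono[OF assms(2) norm_ge_zero[of "x + t *\<^sub>R h"]] by simp
    finally show "norm (x + 0 *\<^sub>R h) + (t - 0) * f h \<le> norm (x + t *\<^sub>R h)"
      using assms(3) by (simp add: blinfun.add_right blinfun.scaleR_right)
  qed
qed

lemma norming_functional_tendsto_1:
  fixes f :: "'a::real_normed_vector \<Rightarrow>\<^sub>L real"
  assumes x: "norm x = 1" and diff: "norm differentiable (at x)"
    and f: "norm f \<le> 1" "f x = 1"
    and s: "\<And>n. norm (s n) \<le> 1" and lim: "(\<lambda>n. norm (x + s n)) \<longlonglongrightarrow> 2"
  shows "(\<lambda>n. f (s n)) \<longlonglongrightarrow> 1"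
proof (rule order_tendstoI)
  fix b :: real assume "1 < b"
  then show "\<forall>\<^sub>F n in sequentially. f (s n) < b"
    using blinfun_apply_le_norm[OF s, of f] f(1)
    by (intro always_eventually allI) (meson le_less_trans order_trans)
next
  fix a :: real assume "a < 1"
  \<comment> \<open>Chosen so that \<open>1 - 2 * e = a\<close>: one \<open>e\<close> pays for the
    differentiability error, the other for the distance of \<open>norm (x + s n)\<close> from
    2.\<close>
  define e where "e = (1 - a) / 2"
  have "e > 0" using \<open>a < 1\<close> by (simp add: e_def)
  obtain D where D: "(norm has_derivative D) (at x)"
    using diff by (auto simp: differentiable_def)
  then have "(norm has_derivative blinfun_apply f) (at x)"
    using has_derivative_norm_eq_norming_functional[OF D f(1)] f(2) x by simp
  then obtain d where "d > 0" and d: "\<And>y. norm (y - x) < d \<Longrightarrow>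
      norm (norm y - norm x - f (y - x)) \<le> e * norm (y - x)"
    using \<open>e > 0\<close> unfolding has_derivative_at_alt by blast
  \<comment> \<open>As \<open>norm (s n) \<le> 1\<close>, \<open>t < d\<close> makes the estimate
    valid at \<open>x + t *\<^sub>R s n\<close> for all \<open>n\<close> at once;
    \<open>t \<le> 1\<close> keeps the coefficient \<open>1 - t\<close> nonnegative.\<close>
  define t where "t = min 1 (d / 2)"
  have t: "0 < t" "t \<le> 1" "t < d" using \<open>d > 0\<close> by (auto simp: t_def)
  have bound: "norm (x + s n) - 2 + t \<le> t * f (s n) + e * t" for n
  proof -
    have ts: "norm (t *\<^sub>R s n) \<le> t"
      using s[of n] t by (simp add: mult_left_le)
    have "norm (norm (x + t *\<^sub>R s n) - 1 - t * f (s n)) \<le> e * norm (t *\<^sub>R s n)"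
      using d[of "x + t *\<^sub>R s n"] le_less_trans[OF ts t(3)] t x by (simp add: blinfun.scaleR_right)
    also have "\<dots> \<le> e * t"
      using ts \<open>e > 0\<close> by (intro mult_left_mono) auto
    finally have upper: "norm (x + t *\<^sub>R s n) \<le> 1 + t * f (s n) + e * t"
      by (simp add: abs_le_iff)
    have "norm (x + s n) = norm ((x + t *\<^sub>R s n) + (1 - t) *\<^sub>R s n)"
      by (simp add: algebra_simps)
    also have "\<dots> \<le> norm (x + t *\<^sub>R s n) + norm ((1 - t) *\<^sub>R s n)"
      by (rule norm_triangle_ineq)
    also have "norm ((1 - t) *\<^sub>R s n) \<le> 1 - t"
      using s[of n] t by (simp add: mult_left_le)
    finally show ?thesis using upper by simp
  qed
  \<comment> \<open>The slack is proportional to the fixed \<open>t\<close>, so that it is still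
    \<open>e\<close> after division by \<open>t\<close>.\<close>
  have "\<forall>\<^sub>F n in sequentially. 2 - t * e < norm (x + s n)"
    using lim t \<open>e > 0\<close> by (intro order_tendstoD(1)) auto
  then show "\<forall>\<^sub>F n in sequentially. a < f (s n)"
  proof eventually_elim
    case (elim n)
    then have "t * (1 - 2 * e) < t * f (s n)"
      using bound[of n] by (simp add: algebra_simps)
    then show ?case using t by (simp add: e_def field_simps)
  qed
qed

text \<open>Here \<open>x\<close> acts as a norming functional on the dual:
  \<open>(f + t *\<^sub>R h) x = norm f + t * h x\<close> is an affine minorant of
  \<open>norm (f + t *\<^sub>R h)\<close> touching it at \<open>t = 0\<close>.\<close>

lemma gateaux_norm_eq_evaluation:
  fixes f h :: "'a::real_normed_vector \<Rightarrow>\<^sub>L real"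
  assumes "gateaux_differentiable norm f"
    and "norm x \<le> 1" "f x = norm f"
  shows "((\<lambda>t. norm (f + t *\<^sub>R h)) has_real_derivative h x) (at 0)"
proof -
  obtain D where "((\<lambda>t. (norm (f + t *\<^sub>R h) - norm f) /\<^sub>R t) \<longlongrightarrow> D h) (at 0)"
    using assms(1) unfolding gateaux_differentiable_def by blast
  then have deriv: "((\<lambda>t. norm (f + t *\<^sub>R h)) has_real_derivative D h) (at 0)"
    by (simp add: DERIV_def divide_inverse_commute)
  then have "D h = h x"
  proof (rule DERIV_eq_subgradient)
    fix t :: real
    show "norm (f + 0 *\<^sub>R h) + (t - 0) * h x \<le> norm (f + t *\<^sub>R h)"
      using blinfun_apply_le_norm[OF assms(2), of "f + t *\<^sub>R h"] assms(3)
      by (simp add: blinfun.add_left blinfun.scaleR_left)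
  qed
  with deriv show ?thesis by simp
qed

lemma eventually_apply_less_of_gateaux:
  fixes f h :: "'a::real_normed_vector \<Rightarrow>\<^sub>L real"
  assumes G: "gateaux_differentiable norm f"
    and x: "norm x \<le> 1" "f x = norm f"
    and s: "\<And>n. norm (s n) \<le> 1" and lim: "(\<lambda>n. f (s n)) \<longlonglongrightarrow> norm f"
    and "h x < b"
  shows "\<forall>\<^sub>F n in sequentially. h (s n) < b"
proof -
  have "((\<lambda>t. (norm (f + t *\<^sub>R h) - norm f) / t) \<longlongrightarrow> h x) (at_right 0)"
    using gateaux_norm_eq_evaluation[OF G x, of h]
    by (auto simp: DERIV_def intro: filterlim_mono[OF _ order_refl] simp: at_le)
  then have "\<forall>\<^sub>F t in at_right 0. (norm (f + t *\<^sub>R h) - norm f) / t < b \<and> 0 < t"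
    using \<open>h x < b\<close>
    by (intro eventually_conj order_tendstoD(2) eventually_at_right_less)
  then obtain t :: real where t: "(norm (f + t *\<^sub>R h) - norm f) / t < b" "0 < t"
    using eventually_happens' trivial_limit_at_right_real by blast
  \<comment> \<open>With \<open>t\<close> fixed independently of \<open>n\<close>, the left side is
    a constant below the limit of \<open>f (s n)\<close>, so \<open>f (s n)\<close> eventually
    exceeds it.\<close>
  then have "norm (f + t *\<^sub>R h) - t * b < norm f"
    by (simp add: field_simps)
  with lim have "\<forall>\<^sub>F n in sequentially. norm (f + t *\<^sub>R h) - t * b < f (s n)"
    by (rule order_tendstoD(1))
  then show ?thesis
  proof eventually_elim
    case (elim n)
    have "f (s n) + t * h (s n) \<le> norm (f + t *\<^sub>R h)"
      using blinfun_apply_le_norm[OF s, of "f + t *\<^sub>R h" n]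
      by (simp add: blinfun.add_left blinfun.scaleR_left)
    with elim have "t * h (s n) < t * b" by linarith
    with \<open>0 < t\<close> show ?case by simp
  qed
qed

theorem proposition2p2:
  fixes x :: "'a::banach" and f :: "'a \<Rightarrow>\<^sub>L real"
  assumes "F_smooth x"
    and "G_smooth f"
    and "blinfun_apply f x = 1"
  shows "wLUR_point x"
proof -
  have x: "norm x = 1" "norm differentiable (at x)"
    using assms(1) by (auto simp: F_smooth_def)
  have f: "norm f = 1" "gateaux_differentiable norm f"
    using assms(2) by (auto simp: G_smooth_def)
  have "(\<lambda>n. g (s n)) \<longlonglongrightarrow> g x"
    if s: "\<And>n. norm (s n) \<le> 1" and lim: "(\<lambda>n. norm (x + s n)) \<longlonglongrightarrow> 2"
    for s :: "nat \<Rightarrow> 'a" and g :: "'a \<Rightarrow>\<^sub>L real"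
  proof -
    have "(\<lambda>n. f (s n)) \<longlonglongrightarrow> norm f"
      using norming_functional_tendsto_1[OF x _ assms(3) s lim] f by simp
    \<comment> \<open>Stated for arbitrary \<open>h\<close> because it is applied to both
      \<open>g\<close> and \<open>- g\<close>.\<close>
    then have less: "\<forall>\<^sub>F n in sequentially. h (s n) < b" if "h x < b" for h :: "'a \<Rightarrow>\<^sub>L real" and b
      using eventually_apply_less_of_gateaux[OF f(2) _ _ s _ that] x(1) f(1) assms(3) by simp
    show ?thesis
    proof (rule order_tendstoI)
      fix a assume "a < g x"
      then show "\<forall>\<^sub>F n in sequentially. a < g (s n)"
        using less[of "- g" "- a"] by (simp add: blinfun.minus_left)
    qed (rule less)
  qed
  then show ?thesis
    using x(1) by (auto simp: wLUR_point_def limitin_weak_topology)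
qed

end
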